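(* Let $f:\mathbb{R}^n\to\mathbb{R}$, $g:\mathbb{R}^n\to\mathbb{R}^m$, $h:\mathbb{R}^n\to\mathbb{R}^p$ be continuously differentiable and let $\varphi:\mathbb{R}^n\to\mathbb{R}$ be locally Lipschitz continuous. Let $\{(x^k,\lambda^k,\mu^k)\}$ be an infinite sequence generated by the Safeguarded Augmented Lagrangian Method (SALM, described in the context) applied to the problem $$\min_{x\in\mathbb{R}^n} f(x)+\varphi(x)\quad\text{s.t.}\quad g(x)\le 0,\ h(x)=0 .$$ Then every accumulation point $(x^*,\lambda^*,\mu^* )$ of the sequence $\{(x^k,\lambda^k,\mu^k)\}$ is an M-stationary point of this problem.
   Context: Notation: $\|\cdot\|$ is the Euclidean norm; $v_+$ is the componentwise maximum of $v$ and $0$; $\min\{\cdot,\cdot\}$ of vectors is componentwise; vector inequalities are componentwise. Subdifferentials: for a proper lsc $\theta:\mathbb{R}^n\to\mathbb{R}\cup\{\pm\infty\}$ and $\bar x\in\operatorname{dom}\theta$, the Fréchet subdifferential is $\hat\partial\theta(\bar x)=\{v:\liminf_{x\to\bar x,\,x\ne\bar x}\frac{\theta(x)-\theta(\bar x)-v^T(x-\bar x)}{\|x-\bar x\|}\ge 0\}$, and the limiting (Mordukhovich) subdifferential $\partial\theta(\bar x)$ is the set of all $v$ for which there exist $x^k\to\bar x$ with $\theta(x^k)\to\theta(\bar x)$ and $v^k\to v$ with $v^k\in\hat\partial\theta(x^k)$ for all $k$. A point $\bar x\in\operatorname{dom}\theta$ is $\varepsilon$-stationary for $\min\theta$ if there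 is $\eta\in\partial\theta(\bar x)$ with $\|\eta\|\le\varepsilon$. Augmented Lagrangian ($\rho>0$): $\mathcal{L}_\rho(x,\lambda,\mu)=f(x)+\varphi(x)+\frac{\rho}{2}\left(\left\|\left(g(x)+\frac{\lambda}{\rho}\right)_+\right\|^2+\left\|h(x)+\frac{\mu}{\rho}\right\|^2\right)$. SALM: Data: $u_{\max}>0$, $v_{\min}<v_{\max}$, sequences $\{u^k\}_{k\ge0}\subseteq[0,u_{\max}]^m$ and $\{v^k\}_{k\ge0}\subseteq[v_{\min},v_{\max}]^p$, a sequence $\varepsilon_k>0$ with $\varepsilon_k\to0$, a starting point $(x^0,\lambda^0,\mu^0)\in\mathbb{R}^n\times\mathbb{R}^m_+\times\mathbb{R}^p$, $\rho_0>0$, $\tau\in(0,1)$, $\gamma>1$. For $k=0,1,2,\dots$ (the method is assumed not to terminate): (1) choose $x^{k+1}$ as an $\varepsilon_k$-stationary point of $\min_x\mathcal{L}_{\rho_k}(x,u^k,v^k)$; (2) set $\lambda_i^{k+1}=(u_i^k+\rho_kg_i(x^{k+1}))_+$ for $i=1,\dots,m$ and $\mu_j^{k+1}=v_j^k+\rho_kh_j(x^{k+1})$ for $j=1,\dots,p$; (3) if $k=0$, or if both $\|h(x^{k+1})\|\le\tau\|h(x^k)\|$ and $\left\|\min\{-g(x^{k+1}),u^k/\rho_k\}\right\|\le\tau\left\|\min\{-g(x^k),u^{k-1}/\rho_{k-1}\}\right\|$, set $\rho_{k+1}=\rho_k$; otherwise set $\rho_{k+1}=\gamma\rho_k$. M-stationarity: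 $(x^*,\lambda^*,\mu^* )\in\mathbb{R}^n\times\mathbb{R}^m_+\times\mathbb{R}^p$ is an M-stationary point of the problem if $0\in\nabla f(x^* )+\partial\varphi(x^* )+\sum_{i=1}^m\lambda_i^*\nabla g_i(x^* )+\sum_{j=1}^p\mu_j^*\nabla h_j(x^* )$, $h(x^* )=0$, $g(x^* )\le0$, and $(\lambda^* )^Tg(x^* )=0$. *)

theory Defs
  imports "HOL-Analysis.Analysis"
begin

definition cont_differentiable :: "('a::real_normed_vector \<Rightarrow> 'b::real_normed_vector) \<Rightarrow> bool" where
  "cont_differentiable F \<longleftrightarrow>
     (\<exists>F' :: 'a \<Rightarrow> 'a \<Rightarrow>\<^sub>L 'b.
        (\<forall>x. (F has_derivative blinfun_apply (F' x)) (at x)) \<and> continuous_on UNIV F')"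

text \<open>Only meaningful at points of differentiability.\<close>

definition gradient :: "('a::euclidean_space \<Rightarrow> real) \<Rightarrow> 'a \<Rightarrow> 'a" where
  "gradient F x = (THE D. GDERIV F x :> D)"

definition locally_lipschitz :: "('a::metric_space \<Rightarrow> 'b::metric_space) \<Rightarrow> bool" where
  "locally_lipschitz F \<longleftrightarrow> (\<forall>x. \<exists>r>0. \<exists>L. L-lipschitz_on (cball x r) F)"

text \<open>
  Both subdifferentials are empty outside the effective domain. The library's \<^term>\<open>at x\<close>
  is the punctured neighbourhood filter, so the Liminf below ranges over points different
  from the base point.
\<close>

definition frechet_subdiff :: "('a::euclidean_space \<Rightarrow> ereal) \<Rightarrow> 'a \<Rightarrow> 'a set" where
  "frechet_subdiff \<theta> x =
     {v. \<bar>\<theta> x\<bar> \<noteq> \<infinity> \<and>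
         Liminf (at x) (\<lambda>y. (\<theta> y - \<theta> x - ereal (v \<bullet> (y - x))) / ereal (norm (y - x))) \<ge> 0}"

definition limiting_subdiff :: "('a::euclidean_space \<Rightarrow> ereal) \<Rightarrow> 'a \<Rightarrow> 'a set" where
  "limiting_subdiff \<theta> x =
     {v. \<bar>\<theta> x\<bar> \<noteq> \<infinity> \<and>
         (\<exists>xs vs. xs \<longlonglongrightarrow> x \<and> (\<lambda>k. \<theta> (xs k)) \<longlonglongrightarrow> \<theta> x \<and> vs \<longlonglongrightarrow> v \<and>
                  (\<forall>k. vs k \<in> frechet_subdiff \<theta> (xs k)))}"

definition eps_stationary :: "real \<Rightarrow> ('a::euclidean_space \<Rightarrow> ereal) \<Rightarrow> 'a \<Rightarrow> bool" where
  "eps_stationary \<epsilon> \<theta> x \<longleftrightarrow> (\<exists>\<eta>\<in>limiting_subdiff \<theta> x. norm \<eta> \<le> \<epsilon>)"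

text \<open>
  On \<^typ>\<open>real^'n\<close> the order and the lattice operations are componentwise, so \<^term>\<open>sup\<close> and
  \<^term>\<open>inf\<close> are the componentwise maximum and minimum.
\<close>

definition pos_part :: "real^'n \<Rightarrow> real^'n" where
  "pos_part v = sup v 0"

definition aug_lagrangian ::
  "(real^'n \<Rightarrow> real) \<Rightarrow> (real^'n \<Rightarrow> real) \<Rightarrow> (real^'n \<Rightarrow> real^'m) \<Rightarrow> (real^'n \<Rightarrow> real^'p) \<Rightarrow>
   real \<Rightarrow> real^'n \<Rightarrow> real^'m \<Rightarrow> real^'p \<Rightarrow> real" where
  "aug_lagrangian f \<phi> g h \<rho> x lam mu =
     f x + \<phi> x + \<rho> / 2 * ((norm (pos_part (g x + lam /\<^sub>R \<rho>)))\<^sup>2 + (norm (h x + mu /\<^sub>R \<rho>))\<^sup>2)"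

text \<open>
  The sequences \<open>x\<close>, \<open>lam\<close>, \<open>mu\<close>, \<open>\<rho>\<close> form a (non-terminating) run of the safeguarded
  augmented Lagrangian method with the remaining arguments as data.
\<close>

definition salm_run ::
  "(real^'n \<Rightarrow> real) \<Rightarrow> (real^'n \<Rightarrow> real) \<Rightarrow> (real^'n \<Rightarrow> real^'m) \<Rightarrow> (real^'n \<Rightarrow> real^'p) \<Rightarrow>
   real \<Rightarrow> real \<Rightarrow> real \<Rightarrow> (nat \<Rightarrow> real^'m) \<Rightarrow> (nat \<Rightarrow> real^'p) \<Rightarrow> (nat \<Rightarrow> real) \<Rightarrow> real \<Rightarrow> real \<Rightarrow>
   (nat \<Rightarrow> real^'n) \<Rightarrow> (nat \<Rightarrow> real^'m) \<Rightarrow> (nat \<Rightarrow> real^'p) \<Rightarrow> (nat \<Rightarrow> real) \<Rightarrow> bool" where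
  "salm_run f \<phi> g h umax vmin vmax u v \<epsilon> \<tau> \<gamma> x lam mu \<rho> \<longleftrightarrow>
     0 < umax \<and> vmin < vmax \<and>
     (\<forall>k i. 0 \<le> u k $ i \<and> u k $ i \<le> umax) \<and>
     (\<forall>k j. vmin \<le> v k $ j \<and> v k $ j \<le> vmax) \<and>
     (\<forall>k. 0 < \<epsilon> k) \<and> \<epsilon> \<longlonglongrightarrow> 0 \<and>
     0 < \<tau> \<and> \<tau> < 1 \<and> 1 < \<gamma> \<and>
     0 \<le> lam 0 \<and> 0 < \<rho> 0 \<and>
     (\<forall>k. eps_stationary (\<epsilon> k) (\<lambda>y. ereal (aug_lagrangian f \<phi> g h (\<rho> k) y (u k) (v k))) (x (Suc k))) \<and>
     (\<forall>k. lam (Suc k) = pos_part (u k + \<rho> k *\<^sub>R g (x (Suc k)))) \<and>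
     (\<forall>k. mu (Suc k) = v k + \<rho> k *\<^sub>R h (x (Suc k))) \<and>
     (\<forall>k. \<rho> (Suc k) =
        (if k = 0 \<or>
            (norm (h (x (Suc k))) \<le> \<tau> * norm (h (x k)) \<and>
             norm (inf (- g (x (Suc k))) (u k /\<^sub>R \<rho> k))
               \<le> \<tau> * norm (inf (- g (x k)) (u (k - 1) /\<^sub>R \<rho> (k - 1))))
         then \<rho> k else \<gamma> * \<rho> k))"

definition M_stationary ::
  "(real^'n \<Rightarrow> real) \<Rightarrow> (real^'n \<Rightarrow> real) \<Rightarrow> (real^'n \<Rightarrow> real^'m) \<Rightarrow> (real^'n \<Rightarrow> real^'p) \<Rightarrow>
   real^'n \<Rightarrow> real^'m \<Rightarrow> real^'p \<Rightarrow> bool" where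
  "M_stationary f \<phi> g h x lam mu \<longleftrightarrow>
     0 \<le> lam \<and>
     (\<exists>\<xi>\<in>limiting_subdiff (\<lambda>y. ereal (\<phi> y)) x.
        0 = gradient f x + \<xi>
          + (\<Sum>i\<in>UNIV. lam $ i *\<^sub>R gradient (\<lambda>y. g y $ i) x)
          + (\<Sum>j\<in>UNIV. mu $ j *\<^sub>R gradient (\<lambda>y. h y $ j) x)) \<and>
     h x = 0 \<and> g x \<le> 0 \<and> lam \<bullet> g x = 0"

definition accumulation_point :: "(nat \<Rightarrow> 'a::topological_space) \<Rightarrow> 'a \<Rightarrow> bool" where
  "accumulation_point s l \<longleftrightarrow> (\<exists>r. strict_mono r \<and> (s \<circ> r) \<longlonglongrightarrow> l)"

end

theory Submission
  imports Defs
begin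

text \<open>
  With \<open>V\<^sup>k = min {- g(x\<^sup>k\<^sup>+\<^sup>1), u\<^sup>k / \<rho>\<^sub>k}\<close> the multiplier updates read
  \<open>V\<^sup>k = (u\<^sup>k - \<lambda>\<^sup>k\<^sup>+\<^sup>1) / \<rho>\<^sub>k\<close> and \<open>h(x\<^sup>k\<^sup>+\<^sup>1) = (\<mu>\<^sup>k\<^sup>+\<^sup>1 - v\<^sup>k) / \<rho>\<^sub>k\<close>. Either the penalty parameter is
  eventually constant, and both residuals decay geometrically by the update test, or it tends to
  infinity, and both residuals vanish along a subsequence with convergent multipliers. In either
  case \<open>V \<rightarrow> 0\<close> gives \<open>g(x\<^sup>*) \<le> 0\<close>, and where \<open>g\<^sub>i(x\<^sup>*) < 0\<close> the minimum is eventually attained by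
  \<open>u\<^sub>i / \<rho>\<close>, so that \<open>\<lambda>\<^sub>i\<close> is eventually zero. The multiplier equation is the limit of the
  approximate stationarity conditions: the smooth part of the augmented Lagrangian splits off from
  the limiting subdifferential, its gradient being the one of the Lagrangian at the new
  multipliers, and the graph of the limiting subdifferential of a continuous function is closed.
\<close>

section \<open>Subdifferential calculus: removing a smooth summand, and closedness of the
  graph\<close>

lemma frechet_subdiff_ereal_iff:
  "v \<in> frechet_subdiff (\<lambda>y. ereal (\<theta> y)) x \<longleftrightarrow>
     (\<forall>e>0. \<forall>\<^sub>F y in at x. - e * norm (y - x) \<le> \<theta> y - \<theta> x - v \<bullet> (y - x))" (is "?L \<longleftrightarrow> ?R")
proof -
  let ?q = "\<lambda>y. (ereal (\<theta> y) - ereal (\<theta> x) - ereal (v \<bullet> (y - x))) / ereal (norm (y - x))"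
  have q: "?q y = ereal ((\<theta> y - \<theta> x - v \<bullet> (y - x)) / norm (y - x))" if "y \<noteq> x" for y
    using that by simp
  have ne: "\<forall>\<^sub>F y in at x. y \<noteq> x"
    by (simp add: eventually_at_filter)
  have "?L \<longleftrightarrow> (\<forall>c<0. \<forall>\<^sub>F y in at x. c < ?q y)"
    by (simp add: frechet_subdiff_def le_Liminf_iff)
  also have "\<dots> \<longleftrightarrow> ?R"
  proof (intro iffI allI impI)
    fix e :: real assume A: "\<forall>c<0. \<forall>\<^sub>F y in at x. c < ?q y" and "e > 0"
    then have "\<forall>\<^sub>F y in at x. ereal (- e) < ?q y" by auto
    with ne show "\<forall>\<^sub>F y in at x. - e * norm (y - x) \<le> \<theta> y - \<theta> x - v \<bullet> (y - x)"
    proof eventually_elim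
      case (elim y)
      then have "- e < (\<theta> y - \<theta> x - v \<bullet> (y - x)) / norm (y - x)"
        unfolding q[OF elim(1)] by simp
      then show ?case using elim(1) by (simp add: less_divide_eq)
    qed
  next
    fix c :: ereal assume R: ?R and "c < 0"
    \<comment> \<open>\<open>c\<close> may be minus infinity and the bound in \<open>?R\<close> is
      not strict; a real \<open>z\<close> strictly between \<open>c\<close> and 0 takes care of
      both.\<close>
    then obtain z where z: "c < ereal z" "z < 0"
      using ereal_dense2[of c 0] by (auto simp: zero_ereal_def)
    with R have "\<forall>\<^sub>F y in at x. - (- z) * norm (y - x) \<le> \<theta> y - \<theta> x - v \<bullet> (y - x)"
      by (metis neg_0_less_iff_less)
    with ne show "\<forall>\<^sub>F y in at x. c < ?q y"
    proof eventually_elim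
      case (elim y)
      then have "z \<le> (\<theta> y - \<theta> x - v \<bullet> (y - x)) / norm (y - x)"
        by (simp add: le_divide_eq)
      then show ?case unfolding q[OF elim(1)] using z(1)
        by (meson ereal_less_eq(3) less_le_trans)
    qed
  qed
  finally show ?thesis .
qed

text \<open>Replacing \<open>S\<close> by its linearisation at \<open>x\<close> costs only
  o(\<open>norm (y - x)\<close>). Half of \<open>e\<close> pays for this remainder, the other half
  for the inequality defining \<open>v\<close>.\<close>

lemma frechet_subdiff_diff_gderiv:
  assumes v: "v \<in> frechet_subdiff (\<lambda>y. ereal (\<theta> y + S y)) x" and S: "GDERIV S x :> G"
  shows "v - G \<in> frechet_subdiff (\<lambda>y. ereal (\<theta> y)) x"
  unfolding frechet_subdiff_ereal_iff
proof (intro allI impI)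
  fix e :: real assume "e > 0"
  then have e: "e / 2 > 0" by simp
  from v e have "\<forall>\<^sub>F y in at x. - (e / 2) * norm (y - x) \<le> (\<theta> y + S y) - (\<theta> x + S x) - v \<bullet> (y - x)"
    unfolding frechet_subdiff_ereal_iff by blast
  moreover have "\<forall>\<^sub>F y in at x. norm (S y - S x - (y - x) \<bullet> G) \<le> (e / 2) * norm (y - x)"
    using S e unfolding gderiv_def has_derivative_within_alt2 by blast
  ultimately show "\<forall>\<^sub>F y in at x. - e * norm (y - x) \<le> \<theta> y - \<theta> x - (v - G) \<bullet> (y - x)"
  proof eventually_elim
    case (elim y)
    have "(y - x) \<bullet> G = G \<bullet> (y - x)" by (rule inner_commute)
    with elim have 1: "- (e / 2) * norm (y - x) \<le> (\<theta> y + S y) - (\<theta> x + S x) - v \<bullet> (y - x)"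
      and 2: "\<bar>S y - S x - G \<bullet> (y - x)\<bar> \<le> (e / 2) * norm (y - x)" by auto
    from 1 abs_le_D1[OF 2] show ?case by (simp add: inner_diff_left[of v G])
  qed
qed

text \<open>The Frechet rule is applied at each approximating point \<open>xs k\<close>. Continuity
  of \<open>G\<close> at \<open>x\<close> makes the shifted subgradients converge, and continuity of
  \<open>S\<close> turns convergence of the values of the sum into convergence of the values of
  \<open>\<theta>\<close>.\<close>

lemma limiting_subdiff_diff_gderiv:
  assumes v: "v \<in> limiting_subdiff (\<lambda>y. ereal (\<theta> y + S y)) x"
    and S: "\<And>y. GDERIV S y :> G y" and G: "isCont G x"
  shows "v - G x \<in> limiting_subdiff (\<lambda>y. ereal (\<theta> y)) x"
proof -
  from v obtain xs vs where xs: "xs \<longlonglongrightarrow> x" and vs: "vs \<longlonglongrightarrow> v"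
    and val: "(\<lambda>k. \<theta> (xs k) + S (xs k)) \<longlonglongrightarrow> \<theta> x + S x"
    and sub: "\<And>k. vs k \<in> frechet_subdiff (\<lambda>y. ereal (\<theta> y + S y)) (xs k)"
    unfolding limiting_subdiff_def by auto
  have "isCont S x"
    using S[of x] has_derivative_continuous unfolding gderiv_def by blast
  then have "(\<lambda>k. S (xs k)) \<longlonglongrightarrow> S x"
    using xs by (rule isCont_tendsto_compose)
  from tendsto_diff[OF val this] have "(\<lambda>k. \<theta> (xs k)) \<longlonglongrightarrow> \<theta> x" by simp
  moreover have "(\<lambda>k. vs k - G (xs k)) \<longlonglongrightarrow> v - G x"
    by (intro tendsto_diff vs isCont_tendsto_compose[OF G xs])
  moreover have "vs k - G (xs k) \<in> frechet_subdiff (\<lambda>y. ereal (\<theta> y)) (xs k)" for k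
    using sub S by (rule frechet_subdiff_diff_gderiv)
  ultimately show ?thesis
    unfolding limiting_subdiff_def using xs by auto
qed

text \<open>A diagonal argument: each pair \<open>(X k, W k)\<close> lies within
  \<open>1 / Suc k\<close> of a point carrying a Frechet subgradient. The value condition is not
  tracked along the diagonal; continuity of \<open>\<theta>\<close> at \<open>x\<close> restores it
  at the end.\<close>

lemma limiting_subdiff_closed_graph:
  assumes X: "X \<longlonglongrightarrow> x" and W: "W \<longlonglongrightarrow> w" and \<theta>: "isCont \<theta> x"
    and sub: "\<And>k. W k \<in> limiting_subdiff (\<lambda>y. ereal (\<theta> y)) (X k)"
  shows "w \<in> limiting_subdiff (\<lambda>y. ereal (\<theta> y)) x"
proof -
  have "\<exists>p. dist (fst p) (X k) < 1 / Suc k \<and> dist (snd p) (W k) < 1 / Suc k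
          \<and> snd p \<in> frechet_subdiff (\<lambda>y. ereal (\<theta> y)) (fst p)" for k
  proof -
    from sub[of k] obtain xs vs where "xs \<longlonglongrightarrow> X k" "vs \<longlonglongrightarrow> W k"
      and fr: "\<And>j. vs j \<in> frechet_subdiff (\<lambda>y. ereal (\<theta> y)) (xs j)"
      unfolding limiting_subdiff_def by auto
    then have "\<forall>\<^sub>F j in sequentially. dist (xs j) (X k) < 1 / Suc k \<and> dist (vs j) (W k) < 1 / Suc k"
      by (auto intro!: eventually_conj tendstoD)
    then obtain j where "dist (xs j) (X k) < 1 / Suc k" "dist (vs j) (W k) < 1 / Suc k"
      by (auto dest: eventually_happens)
    with fr show ?thesis by (intro exI[of _ "(xs j, vs j)"]) auto
  qed
  then obtain P where P: "\<And>k. dist (fst (P k)) (X k) < 1 / Suc k"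
      "\<And>k. dist (snd (P k)) (W k) < 1 / Suc k"
      "\<And>k. snd (P k) \<in> frechet_subdiff (\<lambda>y. ereal (\<theta> y)) (fst (P k))"
    by metis
  have null: "(\<lambda>k. 1 / real (Suc k)) \<longlonglongrightarrow> 0"
    by (rule LIMSEQ_Suc) (rule lim_1_over_n)
  have lim: "Q \<longlonglongrightarrow> q" if Z: "Z \<longlonglongrightarrow> q" and d: "\<And>k. dist (Q k) (Z k) < 1 / Suc k"
    for Q Z :: "nat \<Rightarrow> 'a" and q
  proof -
    have "(\<lambda>k. Q k - Z k) \<longlonglongrightarrow> 0"
      using null by (rule Lim_null_comparison[rotated]) (use d in \<open>auto simp: dist_norm less_imp_le\<close>)
    from tendsto_add[OF this Z] show ?thesis by simp
  qed
  have fst: "(\<lambda>k. fst (P k)) \<longlonglongrightarrow> x"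
    using X P(1) by (rule lim)
  have snd: "(\<lambda>k. snd (P k)) \<longlonglongrightarrow> w"
    using W P(2) by (rule lim)
  have "(\<lambda>k. \<theta> (fst (P k))) \<longlonglongrightarrow> \<theta> x"
    using \<theta> fst by (rule isCont_tendsto_compose)
  with fst snd show ?thesis
    unfolding limiting_subdiff_def
    using P(3) by auto
qed

section \<open>Continuity and gradients of the problem data\<close>

lemma locally_lipschitz_isCont:
  assumes "locally_lipschitz F"
  shows "isCont F x"
proof -
  obtain r L where r: "r > 0" and L: "L-lipschitz_on (cball x r) F"
    using assms unfolding locally_lipschitz_def by blast
  have "continuous_on (ball x r) F"
    using lipschitz_on_continuous_on[OF L] ball_subset_cball by (rule continuous_on_subset)
  with r show ?thesis
    by (simp add: continuous_on_eq_continuous_at)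
qed

lemma gradient_eqI: "GDERIV F x :> D \<Longrightarrow> gradient F x = D"
  unfolding gradient_def
proof (rule the_equality)
  fix D' assume "GDERIV F x :> D'" and "GDERIV F x :> D"
  then have "(\<lambda>h. h \<bullet> D') = (\<lambda>h. h \<bullet> D)"
    unfolding gderiv_def by (rule has_derivative_unique)
  then have "\<forall>h. h \<bullet> D' = h \<bullet> D" by (simp add: fun_eq_iff)
  then show "D' = D" unfolding vector_eq_ldot .
qed

lemma cont_differentiable_gradient:
  fixes F :: "'a::euclidean_space \<Rightarrow> real"
  assumes "cont_differentiable F"
  shows "GDERIV F x :> gradient F x" and "isCont (gradient F) x"
proof -
  obtain F' :: "'a \<Rightarrow> 'a \<Rightarrow>\<^sub>L real" where F': "\<And>x. (F has_derivative blinfun_apply (F' x)) (at x)"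
    and cont: "continuous_on UNIV F'"
    using assms unfolding cont_differentiable_def by blast
  \<comment> \<open>The Riesz vector of \<open>F' x\<close> in coordinates; in this form it inherits
    continuity in \<open>x\<close> from \<open>F'\<close>.\<close>
  define D where "D x = (\<Sum>b\<in>Basis. blinfun_apply (F' x) b *\<^sub>R b)" for x
  have "blinfun_apply (F' x) = (\<lambda>h. h \<bullet> D x)" for x
  proof
    fix h
    have "blinfun_apply (F' x) h = blinfun_apply (F' x) (\<Sum>b\<in>Basis. (h \<bullet> b) *\<^sub>R b)"
      by (simp add: euclidean_representation)
    also have "\<dots> = h \<bullet> D x"
      by (simp add: blinfun.sum_right blinfun.scaleR_right D_def inner_sum_right mult.commute)
    finally show "blinfun_apply (F' x) h = h \<bullet> D x" .
  qed
  then have D: "GDERIV F x :> D x" for x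
    using F'[of x] by (simp add: gderiv_def)
  then have eq: "gradient F = D"
    using gradient_eqI by blast
  show "GDERIV F x :> gradient F x"
    using D eq by simp
  have "continuous_on UNIV D"
    unfolding D_def by (intro continuous_intros cont)
  then show "isCont (gradient F) x"
    unfolding eq by (simp add: continuous_on_eq_continuous_at)
qed

lemma cont_differentiable_vec_nth:
  assumes "cont_differentiable F"
  shows "cont_differentiable (\<lambda>y. F y $ i)"
proof -
  obtain F' where F': "\<And>x. (F has_derivative blinfun_apply (F' x)) (at x)"
    and cont: "continuous_on UNIV F'"
    using assms unfolding cont_differentiable_def by blast
  define P where "P = Blinfun (\<lambda>w::'b^'c. w $ i)"
  have P: "blinfun_apply P = (\<lambda>w. w $ i)"
    unfolding P_def by (rule bounded_linear_Blinfun_apply) (rule bounded_linear_vec_nth)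
  show ?thesis
    unfolding cont_differentiable_def
  proof (intro exI conjI allI)
    show "((\<lambda>y. F y $ i) has_derivative blinfun_apply (P o\<^sub>L F' x)) (at x)" for x
      using bounded_linear.has_derivative[OF bounded_linear_vec_nth F', of i x]
      by (simp add: P comp_def blinfun_apply_blinfun_compose[abs_def])
    show "continuous_on UNIV (\<lambda>x. P o\<^sub>L F' x)"
      by (intro continuous_intros cont)
  qed
qed

lemma cont_differentiable_isCont:
  assumes "cont_differentiable F"
  shows "isCont F x"
proof -
  obtain F' where "(F has_derivative blinfun_apply (F' x)) (at x)"
    using assms unfolding cont_differentiable_def by blast
  then show ?thesis by (rule has_derivative_continuous)
qed

lemma GDERIV_sum:
  assumes "\<And>i. i \<in> I \<Longrightarrow> GDERIV (F i) x :> D i"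
  shows "GDERIV (\<lambda>y. \<Sum>i\<in>I. F i y) x :> (\<Sum>i\<in>I. D i)"
proof -
  have "((\<lambda>y. \<Sum>i\<in>I. F i y) has_derivative (\<lambda>h. \<Sum>i\<in>I. h \<bullet> D i)) (at x)"
    using assms by (intro has_derivative_sum) (simp add: gderiv_def)
  then show ?thesis by (simp add: gderiv_def inner_sum_right)
qed

section \<open>The gradient of the smooth part of the augmented Lagrangian\<close>

lemma DERIV_max_0_square: "DERIV (\<lambda>t::real. (max t 0)\<^sup>2) s :> 2 * max s 0"
proof (cases "s = 0")
  case True
  \<comment> \<open>At the kink the square leaves a difference quotient of absolute value at most
    that of \<open>t\<close>. Away from it the function agrees locally with the square or with
    0.\<close>
  have "((\<lambda>t::real. (max t 0)\<^sup>2 / t) \<longlongrightarrow> 0) (at 0)"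
  proof (rule Lim_null_comparison)
    show "\<forall>\<^sub>F t in at 0. norm ((max t 0)\<^sup>2 / t) \<le> \<bar>t::real\<bar>"
      by (rule always_eventually) (auto simp: max_def power2_eq_square)
    show "((\<lambda>t::real. \<bar>t\<bar>) \<longlongrightarrow> 0) (at 0)"
      by (rule tendsto_eq_intros refl | simp)+
  qed
  then show ?thesis using True by (simp add: DERIV_def)
next
  case False
  show ?thesis
  proof (cases "s > 0")
    case True
    then have "\<forall>\<^sub>F t in nhds s. (max t 0)\<^sup>2 = t\<^sup>2"
      using eventually_nhds_in_open[of "{0<..}" s] by (auto elim!: eventually_mono)
    moreover have "DERIV (\<lambda>t. t\<^sup>2) s :> 2 * max s 0"
      using True by (auto intro!: derivative_eq_intros)
    ultimately show ?thesis by (subst DERIV_cong_ev[OF refl _ refl])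
  next
    case neg: False
    with False have "s < 0" by simp
    then have "\<forall>\<^sub>F t in nhds s. (max t 0)\<^sup>2 = 0"
      using eventually_nhds_in_open[of "{..<0}" s] by (auto elim!: eventually_mono)
    moreover have "DERIV (\<lambda>t. 0) s :> 2 * max s 0"
      using \<open>s < 0\<close> by simp
    ultimately show ?thesis by (subst DERIV_cong_ev[OF refl _ refl])
  qed
qed

lemma pos_part_nth: "pos_part w $ i = max (w $ i) 0"
  by (simp add: pos_part_def sup_vec_def sup_max)

lemma norm_power2_vec: "(norm (w::real^'n))\<^sup>2 = (\<Sum>i\<in>UNIV. (w $ i)\<^sup>2)"
  by (simp add: norm_vec_def L2_set_def sum_nonneg)

text \<open>The smooth part of the multiplier equation, kept as one function of point and
  multipliers so that it can be evaluated at the iterates and passed to the limit as a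
  whole.\<close>

definition lagrangian_gradient ::
  "(real^'n \<Rightarrow> real) \<Rightarrow> (real^'n \<Rightarrow> real^'m) \<Rightarrow> (real^'n \<Rightarrow> real^'p) \<Rightarrow>
   real^'n \<Rightarrow> real^'m \<Rightarrow> real^'p \<Rightarrow> real^'n" where
  "lagrangian_gradient f g h x lam mu =
     gradient f x + (\<Sum>i\<in>UNIV. lam $ i *\<^sub>R gradient (\<lambda>y. g y $ i) x)
       + (\<Sum>j\<in>UNIV. mu $ j *\<^sub>R gradient (\<lambda>y. h y $ j) x)"

text \<open>The filter is arbitrary because the lemma serves twice: with \<open>at x\<close> for
  continuity of the smooth part's gradient, and with \<open>sequentially\<close> for the final
  limit.\<close>

lemma tendsto_lagrangian_gradient:
  assumes f: "cont_differentiable f" and g: "cont_differentiable g" and h: "cont_differentiable h"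
    and x: "(X \<longlongrightarrow> x) F" and lam: "(Lam \<longlongrightarrow> lam) F" and mu: "(Mu \<longlongrightarrow> mu) F"
  shows "((\<lambda>k. lagrangian_gradient f g h (X k) (Lam k) (Mu k))
           \<longlongrightarrow> lagrangian_gradient f g h x lam mu) F"
  unfolding lagrangian_gradient_def
  by (intro tendsto_intros lam mu
      isCont_tendsto_compose[OF cont_differentiable_gradient(2)[OF f] x]
      isCont_tendsto_compose[OF cont_differentiable_gradient(2)[OF cont_differentiable_vec_nth[OF g]] x]
      isCont_tendsto_compose[OF cont_differentiable_gradient(2)[OF cont_differentiable_vec_nth[OF h]] x])

text \<open>By the chain rule each squared penalty contributes the factor \<open>\<rho>\<close>,
  which cancels the shift's denominator:
  \<open>\<rho> * max (g + u / \<rho>) 0 = max (u + \<rho> * g) 0\<close>, and likewise for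
  \<open>h\<close>. These are exactly the multiplier updates of the method.\<close>

lemma GDERIV_aug_lagrangian_smooth:
  assumes f: "cont_differentiable f" and g: "cont_differentiable g" and h: "cont_differentiable h"
    and \<rho>: "\<rho> > 0"
  shows "GDERIV (\<lambda>y. aug_lagrangian f (\<lambda>_. 0) g h \<rho> y u v) x :>
           lagrangian_gradient f g h x (pos_part (u + \<rho> *\<^sub>R g x)) (v + \<rho> *\<^sub>R h x)"
proof -
  note df = cont_differentiable_gradient(1)[OF f, of x]
  have dg: "((\<lambda>y. g y $ i) has_derivative (\<lambda>d. d \<bullet> gradient (\<lambda>y. g y $ i) x)) (at x)" for i
    using cont_differentiable_gradient(1)[OF cont_differentiable_vec_nth[OF g]]
    by (simp add: gderiv_def)
  have dh: "((\<lambda>y. h y $ j) has_derivative (\<lambda>d. d \<bullet> gradient (\<lambda>y. h y $ j) x)) (at x)" for j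
    using cont_differentiable_gradient(1)[OF cont_differentiable_vec_nth[OF h]]
    by (simp add: gderiv_def)
  have G: "GDERIV (\<lambda>y. \<rho> / 2 * (max (g y $ i + u $ i / \<rho>) 0)\<^sup>2) x :>
             pos_part (u + \<rho> *\<^sub>R g x) $ i *\<^sub>R gradient (\<lambda>y. g y $ i) x" for i
  proof -
    let ?s = "g x $ i + u $ i / \<rho>"
    have 1: "((\<lambda>y. g y $ i + u $ i / \<rho>) has_derivative (\<lambda>d. d \<bullet> gradient (\<lambda>y. g y $ i) x)) (at x)"
      using has_derivative_add[OF dg has_derivative_const] by simp
    have 2: "DERIV (\<lambda>t. \<rho> / 2 * (max t 0)\<^sup>2) ?s :> \<rho> * max ?s 0"
      by (rule DERIV_cong, rule DERIV_cmult, rule DERIV_max_0_square) simp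
    have 3: "\<rho> * max ?s 0 = pos_part (u + \<rho> *\<^sub>R g x) $ i"
      using \<rho> by (simp add: pos_part_nth max_mult_distrib_left algebra_simps)
    show ?thesis
      unfolding gderiv_def
      using has_derivative_compose[OF 1 2[unfolded has_field_derivative_def]]
      by (simp add: 3)
  qed
  have H: "GDERIV (\<lambda>y. \<rho> / 2 * (h y $ j + v $ j / \<rho>)\<^sup>2) x :>
             (v + \<rho> *\<^sub>R h x) $ j *\<^sub>R gradient (\<lambda>y. h y $ j) x" for j
    unfolding gderiv_def
    by (rule has_derivative_eq_rhs, (rule derivative_intros dh)+)
       (use \<rho> in \<open>auto simp: fun_eq_iff field_simps inner_add_right\<close>)
  have pg: "(norm (pos_part (g y + u /\<^sub>R \<rho>)))\<^sup>2 = (\<Sum>i\<in>UNIV. (max (g y $ i + u $ i / \<rho>) 0)\<^sup>2)" for y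
    by (simp add: norm_power2_vec pos_part_nth divide_inverse_commute)
  have ph: "(norm (h y + v /\<^sub>R \<rho>))\<^sup>2 = (\<Sum>j\<in>UNIV. (h y $ j + v $ j / \<rho>)\<^sup>2)" for y
    by (simp add: norm_power2_vec divide_inverse_commute)
  have "(\<lambda>y. aug_lagrangian f (\<lambda>_. 0) g h \<rho> y u v) =
    (\<lambda>y. f y + (\<Sum>i\<in>UNIV. \<rho> / 2 * (max (g y $ i + u $ i / \<rho>) 0)\<^sup>2)
         + (\<Sum>j\<in>UNIV. \<rho> / 2 * (h y $ j + v $ j / \<rho>)\<^sup>2))"
    by (simp only: aug_lagrangian_def pg ph sum_distrib_left[symmetric] distrib_left add.assoc
        add_0_left)
  then show ?thesis
    unfolding lagrangian_gradient_def by (simp only:) (intro GDERIV_add GDERIV_sum df G H)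
qed

text \<open>The augmented Lagrangian is \<open>\<phi>\<close> plus its own instance with zero in
  place of \<open>\<phi>\<close>, so the rule for removing a smooth summand applies.\<close>

lemma limiting_subdiff_aug_lagrangian:
  assumes f: "cont_differentiable f" and g: "cont_differentiable g" and h: "cont_differentiable h"
    and \<rho>: "\<rho> > 0"
    and \<eta>: "\<eta> \<in> limiting_subdiff (\<lambda>y. ereal (aug_lagrangian f \<phi> g h \<rho> y u v)) x"
  shows "\<eta> - lagrangian_gradient f g h x (pos_part (u + \<rho> *\<^sub>R g x)) (v + \<rho> *\<^sub>R h x)
           \<in> limiting_subdiff (\<lambda>y. ereal (\<phi> y)) x"
proof (rule limiting_subdiff_diff_gderiv)
  show "\<eta> \<in> limiting_subdiff (\<lambda>y. ereal (\<phi> y + aug_lagrangian f (\<lambda>_. 0) g h \<rho> y u v)) x"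
    using \<eta> by (simp add: aug_lagrangian_def add_ac)
  show "GDERIV (\<lambda>y. aug_lagrangian f (\<lambda>_. 0) g h \<rho> y u v) y :>
          lagrangian_gradient f g h y (pos_part (u + \<rho> *\<^sub>R g y)) (v + \<rho> *\<^sub>R h y)" for y
    using f g h \<rho> by (rule GDERIV_aug_lagrangian_smooth)
  have "(\<lambda>y. pos_part (u + \<rho> *\<^sub>R g y)) \<midarrow>x\<rightarrow> pos_part (u + \<rho> *\<^sub>R g x)"
    using cont_differentiable_isCont[OF g, of x] unfolding isCont_def
    by (intro vec_tendstoI) (simp add: pos_part_nth, intro tendsto_intros, simp)
  moreover have "(\<lambda>y. v + \<rho> *\<^sub>R h y) \<midarrow>x\<rightarrow> v + \<rho> *\<^sub>R h x"
    using cont_differentiable_isCont[OF h, of x] unfolding isCont_def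
    by (intro tendsto_intros)
  ultimately show "isCont (\<lambda>y. lagrangian_gradient f g h y (pos_part (u + \<rho> *\<^sub>R g y)) (v + \<rho> *\<^sub>R h y)) x"
    unfolding isCont_def by (intro tendsto_lagrangian_gradient f g h tendsto_ident_at)
qed

section \<open>The residual of the inequality constraints and complementarity\<close>

lemma pos_part_update_residual:
  assumes "\<rho> > 0"
  shows "inf (- w) (u /\<^sub>R \<rho>) = (u - pos_part (u + \<rho> *\<^sub>R w)) /\<^sub>R \<rho>"
proof -
  have "min (- b) (a / \<rho>) = (a - max (a + \<rho> * b) 0) / \<rho>" for a b :: real
  proof (cases "0 \<le> a + \<rho> * b")
    case True
    then have "- b \<le> a / \<rho>" using assms by (simp add: pos_le_divide_eq mult.commute)
    then show ?thesis using True assms by (simp add: min_absorb1 max_absorb1)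
  next
    case False
    then have "a / \<rho> \<le> - b" using assms by (simp add: pos_divide_le_eq mult.commute)
    then show ?thesis using False by (simp add: min_absorb2 max_absorb2)
  qed
  then show ?thesis
    by (simp add: vec_eq_iff pos_part_nth inf_vec_def inf_min divide_inverse_commute)
qed

text \<open>Stated without any growth condition on \<open>R\<close>, so that it covers both the
  bounded and the unbounded penalty case.\<close>

lemma complementarity_of_residual_limit:
  assumes W: "(W \<longlongrightarrow> w) F" and L: "((\<lambda>k. pos_part (U k + R k *\<^sub>R W k)) \<longlongrightarrow> lam) F"
    and V: "((\<lambda>k. inf (- W k) (U k /\<^sub>R R k)) \<longlongrightarrow> 0) F"
    and R: "\<And>k. R k > 0" and F: "F \<noteq> bot"
  shows "0 \<le> lam" "w \<le> 0" "lam \<bullet> w = 0"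
proof -
  have Wi: "((\<lambda>k. W k $ i) \<longlongrightarrow> w $ i) F" for i
    using W by (rule tendsto_vec_nth)
  have Li: "((\<lambda>k. max (U k $ i + R k * W k $ i) 0) \<longlongrightarrow> lam $ i) F" for i
    using tendsto_vec_nth[OF L, of i] by (simp add: pos_part_nth)
  have Vi: "((\<lambda>k. min (- (W k $ i)) (U k $ i / R k)) \<longlongrightarrow> 0) F" for i
    using tendsto_vec_nth[OF V, of i] by (simp add: inf_vec_def inf_min divide_inverse mult.commute)
  have "0 \<le> lam $ i" for i
    by (rule tendsto_lowerbound[OF Li _ F]) simp
  then show "0 \<le> lam" by (simp add: less_eq_vec_def)
  \<comment> \<open>The minimum is at most \<open>- W k $ i\<close>; in the limit this reads
    \<open>0 \<le> - w $ i\<close>.\<close>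
  have w: "w $ i \<le> 0" for i
    using tendsto_le[OF F tendsto_minus[OF Wi] Vi, of i] by simp
  then show "w \<le> 0" by (simp add: less_eq_vec_def)
  have "lam $ i = 0" if "w $ i < 0" for i
  proof -
    \<comment> \<open>Adding \<open>W k $ i\<close> reduces the comparison of the minimum with
      \<open>- W k $ i\<close> to the sign of one quantity with limit \<open>w $ i < 0\<close>.
      Eventually the minimum is therefore its second argument.\<close>
    have "((\<lambda>k. min (- (W k $ i)) (U k $ i / R k) + W k $ i) \<longlongrightarrow> 0 + w $ i) F"
      by (intro tendsto_add Vi Wi)
    then have "\<forall>\<^sub>F k in F. min (- (W k $ i)) (U k $ i / R k) + W k $ i < 0"
      using that by (auto dest: order_tendstoD(2))
    then have "\<forall>\<^sub>F k in F. max (U k $ i + R k * W k $ i) 0 = 0"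
    proof eventually_elim
      case (elim k)
      then have "U k $ i / R k < - (W k $ i)" by (auto simp: min_def split: if_splits)
      then have "U k $ i < - (W k $ i) * R k"
        using R[of k] by (simp add: pos_divide_less_eq)
      then show ?case by (simp add: algebra_simps)
    qed
    then have "((\<lambda>k. max (U k $ i + R k * W k $ i) 0) \<longlongrightarrow> 0) F"
      by (rule tendsto_eventually)
    with Li show ?thesis using F tendsto_unique by blast
  qed
  with w have "lam $ i * w $ i = 0" for i
    by (metis less_eq_real_def mult_eq_0_iff)
  then have "(\<Sum>i\<in>UNIV. lam $ i * w $ i) = 0" by (intro sum.neutral) blast
  then show "lam \<bullet> w = 0" by (simp add: inner_vec_def)
qed

section \<open>Behaviour of the penalty parameter and vanishing of the residuals\<close>

lemma tendsto_0_scaled_of_bounded: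
  fixes B :: "nat \<Rightarrow> real^'n"
  assumes A: "A \<longlonglongrightarrow> a" and B: "\<And>k i. c \<le> B k $ i \<and> B k $ i \<le> d"
    and R: "filterlim R at_top sequentially"
  shows "(\<lambda>k. (A k - B k) /\<^sub>R R k) \<longlonglongrightarrow> 0"
proof -
  have inv: "(\<lambda>k. inverse (R k)) \<longlonglongrightarrow> 0"
    using R by (rule tendsto_inverse_0_at_top)
  have "norm (B k) \<le> (\<Sum>i\<in>(UNIV::'n set). \<bar>c\<bar> + \<bar>d\<bar>)" for k
    by (rule order_trans[OF norm_le_l1_cart sum_mono]) (use B[of k] in \<open>smt (verit)\<close>)
  then have "Bfun B sequentially"
    by (intro BfunI always_eventually) blast
  moreover have "Zfun (\<lambda>k. inverse (R k)) sequentially"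
    using inv by (simp add: tendsto_Zfun_iff)
  \<comment> \<open>\<open>B\<close> is bounded but need not converge, so this is a null sequence
    times a bounded one rather than a product of limits.\<close>
  ultimately have "(\<lambda>k. inverse (R k) *\<^sub>R B k) \<longlonglongrightarrow> 0"
    using bounded_bilinear.Zfun_prod_Bfun[OF bounded_bilinear_scaleR] by (simp add: tendsto_Zfun_iff)
  from tendsto_diff[OF tendsto_scaleR[OF inv A] this] show ?thesis
    by (simp add: scaleR_diff_right)
qed

text \<open>By the ratio test the series of the \<open>a k\<close> converges, hence its terms
  vanish.\<close>

lemma geometric_decay_tendsto_0:
  fixes a :: "nat \<Rightarrow> 'a::banach"
  assumes "\<tau> < 1" and "\<forall>\<^sub>F k in sequentially. norm (a (Suc k)) \<le> \<tau> * norm (a k)"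
  shows "a \<longlonglongrightarrow> 0"
proof -
  obtain N where "\<And>k. k \<ge> N \<Longrightarrow> norm (a (Suc k)) \<le> \<tau> * norm (a k)"
    using assms(2) by (auto simp: eventually_sequentially)
  with assms(1) show ?thesis
    by (intro summable_LIMSEQ_zero summable_ratio_test)
qed

text \<open>If the parameter is not eventually constant, it is multiplied by \<open>\<gamma>\<close>
  infinitely often; being monotone, it passes every \<open>\<gamma> ^ n * \<rho> 0\<close>.\<close>

lemma penalty_dichotomy:
  fixes \<rho> :: "nat \<Rightarrow> real"
  assumes "0 < \<rho> 0" "1 < \<gamma>" and step: "\<And>k. \<rho> (Suc k) = \<rho> k \<or> \<rho> (Suc k) = \<gamma> * \<rho> k"
  shows "(\<forall>\<^sub>F k in sequentially. \<rho> (Suc k) = \<rho> k) \<or> filterlim \<rho> at_top sequentially"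
proof (rule disjCI)
  assume nf: "\<not> filterlim \<rho> at_top sequentially"
  have pos: "0 < \<rho> k" for k
    using assms by (induction k) (auto, metis less_trans mult_pos_pos zero_less_one)
  have Suc: "\<rho> k \<le> \<rho> (Suc k)" for k
    using step[of k] pos[of k] \<open>1 < \<gamma>\<close> by auto
  have mono: "incseq \<rho>" using Suc by (rule incseq_SucI)
  show "\<forall>\<^sub>F k in sequentially. \<rho> (Suc k) = \<rho> k"
  proof (rule ccontr)
    assume "\<not> ?thesis"
    then have "\<exists>k\<ge>N. \<rho> (Suc k) \<noteq> \<rho> k" for N
      by (auto simp: eventually_sequentially)
    then have inf: "\<exists>k\<ge>N. \<rho> (Suc k) = \<gamma> * \<rho> k" for N
      using step by blast
    have ex: "\<exists>k. \<gamma> ^ n * \<rho> 0 \<le> \<rho> k" for n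
    proof (induction n)
      case (Suc n)
      then obtain k where k: "\<gamma> ^ n * \<rho> 0 \<le> \<rho> k" by blast
      obtain l where l: "l \<ge> k" "\<rho> (Suc l) = \<gamma> * \<rho> l" using inf by blast
      have "\<gamma> * (\<gamma> ^ n * \<rho> 0) \<le> \<gamma> * \<rho> l"
        using k incseqD[OF mono l(1)] \<open>1 < \<gamma>\<close> by (intro mult_left_mono) auto
      then show ?case using l(2) by (intro exI[of _ "Suc l"]) (simp add: mult.assoc)
    qed auto
    have "filterlim \<rho> at_top sequentially"
      unfolding filterlim_at_top
    proof
      fix Z
      obtain n where "Z / \<rho> 0 < \<gamma> ^ n" using real_arch_pow[OF \<open>1 < \<gamma>\<close>] by blast
      then have "Z < \<gamma> ^ n * \<rho> 0" using assms(1) by (simp add: pos_divide_less_eq)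
      moreover obtain k where "\<gamma> ^ n * \<rho> 0 \<le> \<rho> k" using ex by blast
      ultimately have "Z \<le> \<rho> l" if "l \<ge> k" for l
        using incseqD[OF mono that] by linarith
      then show "\<forall>\<^sub>F l in sequentially. Z \<le> \<rho> l"
        by (auto simp: eventually_sequentially)
    qed
    with nf show False ..
  qed
qed

text \<open>For bounded penalty the residuals vanish along the whole run and \<open>K\<close> merely
  selects from it. For unbounded penalty each is, up to sign, a convergent multiplier minus a
  bounded safeguard, divided by \<open>\<rho>\<close>.\<close>

lemma salm_run_residuals_tendsto_0:
  assumes run: "salm_run f \<phi> g h umax vmin vmax u v \<epsilon> \<tau> \<gamma> x lam mu \<rho>"
    and K: "strict_mono K"
    and lam: "(\<lambda>k. lam (Suc (K k))) \<longlonglongrightarrow> lam'" and mu: "(\<lambda>k. mu (Suc (K k))) \<longlonglongrightarrow> mu'"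
  shows "(\<lambda>k. inf (- g (x (Suc (K k)))) (u (K k) /\<^sub>R \<rho> (K k))) \<longlonglongrightarrow> 0" (is ?V)
    and "(\<lambda>k. h (x (Suc (K k)))) \<longlonglongrightarrow> 0" (is ?H)
    and "0 < \<rho> k"
proof -
  define V where "V k = inf (- g (x (Suc k))) (u k /\<^sub>R \<rho> k)" for k
  have \<gamma>: "1 < \<gamma>" and \<tau>: "\<tau> < 1" and \<rho>0: "0 < \<rho> 0"
    and ub: "\<And>k i. 0 \<le> u k $ i \<and> u k $ i \<le> umax"
    and vb: "\<And>k j. vmin \<le> v k $ j \<and> v k $ j \<le> vmax"
    and lamS: "\<And>k. lam (Suc k) = pos_part (u k + \<rho> k *\<^sub>R g (x (Suc k)))"
    and muS: "\<And>k. mu (Suc k) = v k + \<rho> k *\<^sub>R h (x (Suc k))"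
    and \<rho>S: "\<And>k. \<rho> (Suc k) =
        (if k = 0 \<or> (norm (h (x (Suc k))) \<le> \<tau> * norm (h (x k)) \<and>
                     norm (V k) \<le> \<tau> * norm (V (k - 1)))
         then \<rho> k else \<gamma> * \<rho> k)"
  proof -
    show "\<rho> (Suc k) =
        (if k = 0 \<or> (norm (h (x (Suc k))) \<le> \<tau> * norm (h (x k)) \<and>
                     norm (V k) \<le> \<tau> * norm (V (k - 1)))
         then \<rho> k else \<gamma> * \<rho> k)" for k
      \<comment> \<open>\<open>V (k - 1)\<close> is evaluated at \<open>x (Suc (k - 1))\<close>,
        which is \<open>x k\<close> only for \<open>k > 0\<close>; at \<open>k = 0\<close> the first
        disjunct decides the test.\<close>
      using run unfolding salm_run_def V_def by (cases k) auto
  qed (use run in \<open>auto simp: salm_run_def\<close>)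
  have pos: "0 < \<rho> k" for k
    using \<rho>0 \<gamma> by (induction k) (auto simp: \<rho>S)
  then show "0 < \<rho> k" .
  have Kinf: "filterlim K sequentially sequentially"
    using K by (rule filterlim_subseq)
  have "\<rho> (Suc k) = \<rho> k \<or> \<rho> (Suc k) = \<gamma> * \<rho> k" for k
    by (auto simp: \<rho>S)
  from penalty_dichotomy[OF \<rho>0 \<gamma> this] have "?V \<and> ?H"
  proof
    assume "\<forall>\<^sub>F k in sequentially. \<rho> (Suc k) = \<rho> k"
    then obtain N where N: "\<And>k. k \<ge> N \<Longrightarrow> \<rho> (Suc k) = \<rho> k"
      by (auto simp: eventually_sequentially)
    \<comment> \<open>As \<open>\<gamma> > 1\<close> and \<open>\<rho> k > 0\<close>, an unchanged
      parameter means that the test succeeded, except at the exempt index 0, which the threshold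
      \<open>Suc N\<close> excludes.\<close>
    have test: "norm (h (x (Suc k))) \<le> \<tau> * norm (h (x k)) \<and> norm (V k) \<le> \<tau> * norm (V (k - 1))"
      if "k \<ge> Suc N" for k
      using N[of k] that pos[of k] \<gamma> by (auto simp: \<rho>S split: if_splits)
    then have "\<forall>\<^sub>F k in sequentially. norm (h (x (Suc k))) \<le> \<tau> * norm (h (x k))"
      unfolding eventually_sequentially by blast
    with \<tau> have "(\<lambda>k. h (x k)) \<longlonglongrightarrow> 0"
      by (rule geometric_decay_tendsto_0)
    then have H: "(\<lambda>k. h (x (Suc k))) \<longlonglongrightarrow> 0"
      by (rule LIMSEQ_Suc)
    have "norm (V (Suc k)) \<le> \<tau> * norm (V k)" if "k \<ge> N" for k
      using test[of "Suc k"] that by simp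
    then have "\<forall>\<^sub>F k in sequentially. norm (V (Suc k)) \<le> \<tau> * norm (V k)"
      unfolding eventually_sequentially by blast
    with \<tau> have V: "V \<longlonglongrightarrow> 0"
      by (rule geometric_decay_tendsto_0)
    show ?thesis
      using filterlim_compose[OF V Kinf] filterlim_compose[OF H Kinf] by (simp add: V_def)
  next
    assume "filterlim \<rho> at_top sequentially"
    then have \<rho>K: "filterlim (\<lambda>k. \<rho> (K k)) at_top sequentially"
      using Kinf by (rule filterlim_compose)
    have "(\<lambda>k. (mu (Suc (K k)) - v (K k)) /\<^sub>R \<rho> (K k)) \<longlonglongrightarrow> 0"
      using mu vb \<rho>K by (rule tendsto_0_scaled_of_bounded)
    then have ?H
      using pos by (simp add: muS less_imp_neq[THEN not_sym])
    moreover have "(\<lambda>k. (lam (Suc (K k)) - u (K k)) /\<^sub>R \<rho> (K k)) \<longlonglongrightarrow> 0"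
      using lam ub \<rho>K by (rule tendsto_0_scaled_of_bounded)
    from tendsto_minus[OF this] have ?V
      by (simp add: pos_part_update_residual[OF pos] lamS scaleR_diff_right)
    ultimately show ?thesis by blast
  qed
  then show ?V ?H by blast+
qed

section \<open>Passage to the limit in the approximate stationarity conditions\<close>

theorem theorem3p4:
  fixes f \<phi> :: "real^'n \<Rightarrow> real"
    and g :: "real^'n \<Rightarrow> real^'m"
    and h :: "real^'n \<Rightarrow> real^'p"
    and umax vmin vmax \<tau> \<gamma> :: real
    and u lam :: "nat \<Rightarrow> real^'m"
    and v mu :: "nat \<Rightarrow> real^'p"
    and \<epsilon> \<rho> :: "nat \<Rightarrow> real"
    and x :: "nat \<Rightarrow> real^'n"
    and x_star :: "real^'n" and lam_star :: "real^'m" and mu_star :: "real^'p"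
  assumes "cont_differentiable f" "cont_differentiable g" "cont_differentiable h"
    and "locally_lipschitz \<phi>"
    and "salm_run f \<phi> g h umax vmin vmax u v \<epsilon> \<tau> \<gamma> x lam mu \<rho>"
    and "accumulation_point (\<lambda>k. (x k, lam k, mu k)) (x_star, lam_star, mu_star)"
  shows "M_stationary f \<phi> g h x_star lam_star mu_star"
proof -
  let ?G = "lagrangian_gradient f g h"
  obtain r where r: "strict_mono r"
    and lim: "((\<lambda>k. (x k, lam k, mu k)) \<circ> r) \<longlonglongrightarrow> (x_star, lam_star, mu_star)"
    using assms(6) unfolding accumulation_point_def by blast
  \<comment> \<open>\<open>K k\<close> is the iteration that produced the iterate with index
    \<open>r (Suc k)\<close>. Dropping \<open>r 0\<close> keeps these indices positive, since the
    starting triple is not the result of an update.\<close>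
  define K where "K k = r (Suc k) - 1" for k
  have "r (Suc k) > 0" for k
    using strict_mono_less[OF r, of 0 "Suc k"] by simp
  then have SucK: "Suc (K k) = r (Suc k)" for k
    by (simp add: K_def)
  have K: "strict_mono K"
  proof (rule strict_monoI)
    fix k l :: nat assume "k < l"
    then have "r (Suc k) < r (Suc l)" using r by (simp add: strict_mono_less)
    then show "K k < K l" using SucK[of k] SucK[of l] by simp
  qed
  have lim': "(\<lambda>k. (x (Suc (K k)), lam (Suc (K k)), mu (Suc (K k)))) \<longlonglongrightarrow> (x_star, lam_star, mu_star)"
    using LIMSEQ_Suc[OF lim] by (simp add: SucK)
  have x: "(\<lambda>k. x (Suc (K k))) \<longlonglongrightarrow> x_star"
    and lam: "(\<lambda>k. lam (Suc (K k))) \<longlonglongrightarrow> lam_star"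
    and mu: "(\<lambda>k. mu (Suc (K k))) \<longlonglongrightarrow> mu_star"
    using tendsto_fst[OF lim'] tendsto_fst[OF tendsto_snd[OF lim']]
      tendsto_snd[OF tendsto_snd[OF lim']] by simp_all
  note res = salm_run_residuals_tendsto_0[OF assms(5) K lam mu]
  have lamS: "\<And>k. lam (Suc k) = pos_part (u k + \<rho> k *\<^sub>R g (x (Suc k)))"
    and muS: "\<And>k. mu (Suc k) = v k + \<rho> k *\<^sub>R h (x (Suc k))"
    and stat: "\<And>k. eps_stationary (\<epsilon> k)
        (\<lambda>y. ereal (aug_lagrangian f \<phi> g h (\<rho> k) y (u k) (v k))) (x (Suc k))"
    and \<epsilon>: "\<epsilon> \<longlonglongrightarrow> 0"
    using assms(5) by (auto simp: salm_run_def)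
  have "(\<lambda>k. h (x (Suc (K k)))) \<longlonglongrightarrow> h x_star"
    using cont_differentiable_isCont[OF assms(3)] x by (rule isCont_tendsto_compose)
  then have h: "h x_star = 0"
    using res(2) LIMSEQ_unique by blast
  have "(\<lambda>k. g (x (Suc (K k)))) \<longlonglongrightarrow> g x_star"
    using cont_differentiable_isCont[OF assms(2)] x by (rule isCont_tendsto_compose)
  note compl = complementarity_of_residual_limit[OF this lam[unfolded lamS] res(1) res(3)
      sequentially_bot]
  obtain \<eta> where \<eta>: "\<And>k. \<eta> k \<in> limiting_subdiff
      (\<lambda>y. ereal (aug_lagrangian f \<phi> g h (\<rho> k) y (u k) (v k))) (x (Suc k))"
    and norm_\<eta>: "\<And>k. norm (\<eta> k) \<le> \<epsilon> k"
    using stat unfolding eps_stationary_def by metis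
  have "\<eta> \<longlonglongrightarrow> 0"
    using always_eventually[OF allI[OF norm_\<eta>]] \<epsilon> by (rule Lim_null_comparison)
  then have "(\<lambda>k. \<eta> (K k)) \<longlonglongrightarrow> 0"
    using filterlim_subseq[OF K] by (rule filterlim_compose)
  then have "(\<lambda>k. \<eta> (K k) - ?G (x (Suc (K k))) (lam (Suc (K k))) (mu (Suc (K k))))
      \<longlonglongrightarrow> 0 - ?G x_star lam_star mu_star"
    by (intro tendsto_diff tendsto_lagrangian_gradient assms x lam mu)
  moreover have "\<eta> k - ?G (x (Suc k)) (lam (Suc k)) (mu (Suc k))
      \<in> limiting_subdiff (\<lambda>y. ereal (\<phi> y)) (x (Suc k))" for k
    unfolding lamS muS using assms(1-3) res(3) \<eta> by (rule limiting_subdiff_aug_lagrangian)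
  \<comment> \<open>The values of \<open>\<phi>\<close> need no separate limit argument: local
    Lipschitz continuity supplies the continuity that the closed graph property asks for.\<close>
  ultimately have "- ?G x_star lam_star mu_star \<in> limiting_subdiff (\<lambda>y. ereal (\<phi> y)) x_star"
    using limiting_subdiff_closed_graph[OF x _ locally_lipschitz_isCont[OF assms(4)]] by simp
  with h compl show ?thesis
    unfolding M_stationary_def
    by (auto intro!: bexI[of _ "- ?G x_star lam_star mu_star"] simp: lagrangian_gradient_def)
qed

end
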